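(* For every integer $n\ge 1$, $$9H_{n+2}-2H_{n+1}+35H_n=41K_n.$$
   Context: The generalized Tribonacci sequence $(H_n)_{n\ge0}$ is defined by $H_0=3$, $H_1=0$, $H_2=2$ and $H_{n+2}=H_{n+1}+H_n+H_{n-1}$ for $n\ge1$. The Tribonacci–Lucas sequence is $K_0=3$, $K_1=1$, $K_2=3$, $K_n=K_{n-1}+K_{n-2}+K_{n-3}$ ($n\ge3$). *)

theory Defs
  imports Main
begin

(* Both sequences are integer-valued, so that the subtraction in identities
   relating them does not truncate. *)

fun H :: "nat \<Rightarrow> int" where
  "H 0 = 3"
| "H (Suc 0) = 0"
| "H (Suc (Suc 0)) = 2"
| "H (Suc (Suc (Suc n))) = H (Suc (Suc n)) + H (Suc n) + H n"

fun K :: "nat \<Rightarrow> int" where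
  "K 0 = 3"
| "K (Suc 0) = 1"
| "K (Suc (Suc 0)) = 3"
| "K (Suc (Suc (Suc n))) = K (Suc (Suc n)) + K (Suc n) + K n"

end

theory Submission
  imports Defs
begin

theorem theorem2p3:
  fixes n :: nat
  assumes "n \<ge> 1"
  shows "9 * H (n + 2) - 2 * H (n + 1) + 35 * H n = 41 * K n"
proof -
  \<comment> \<open>Writing the indices with \<open>Suc\<close> lets the recursion equations of
    \<open>H\<close> rewrite directly.\<close>
  have "9 * H (Suc (Suc n)) - 2 * H (Suc n) + 35 * H n = 41 * K n"
    \<comment> \<open>Both sides are linear in sequences with the same order-3 recurrence, so
      agreement at 0, 1, 2 suffices; \<open>K.induct\<close> supplies these bases and three
      hypotheses. The bases form a 3x3 linear system for the coefficients, with determinant 41;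
      Cramer's rule gives 9, -2, 35 over 41.\<close>
    by (induction n rule: K.induct) simp_all
  then show ?thesis
    by simp
qed

end
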